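(* Let $H$ be a nonempty graph of order $n'$ and let $n\ge 4$ be an integer. If $\gamma_{\rm sp}(H)=n'-1$ and $H\not\cong K_{n'}$, then $$\gamma_{\rm sp}(C_n\circ H)=nn'-\left\lfloor\frac{2n}{3}\right\rfloor.$$ Furthermore, if $\gamma_{\rm sp}(H)\le n'-2$, then $$\gamma_{\rm sp}(C_n\circ H)=\left\lfloor\frac{n}{2}\right\rfloor\gamma_{\rm sp}(H)+n'\left\lceil\frac{n}{2}\right\rceil.$$
   Context: All graphs are finite, simple and undirected; the order of a graph is its number of vertices. A nonempty graph is one with at least one edge. $K_m$ and $C_m$ are the complete graph and the cycle of order $m$. For a vertex $v$ of $G$, $N(v)$ is the set of vertices adjacent to $v$, and for $D\subseteq V(G)$, $\overline{D}=V(G)\setminus D$. A set $D\subseteq V(G)$ is a super dominating set of $G$ if for every $u\in\overline{D}$ there exists $v\in D$ such that $N(v)\cap\overline{D}=\{u\}$. The super domination number $\gamma_{\rm sp}(G)$ is the minimum cardinality of a super dominating set of $G$. The lexicographic product $G\circ H$ has vertex set $V(G)\times V(H)$, and $(g,h)$ is adjacent to $(g',h')$ if and only if $gg'\in E(G)$, or $g=g'$ and $hh'\in E(H)$. *)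

theory Defs
  imports Complex_Main "Graph_Theory.Graph_Theory"
begin

text \<open>Finite simple undirected graphs are values of type \<^typ>\<open>'a pair_pre_digraph\<close> in the
  locale \<^locale>\<open>pair_graph\<close>: finite, loop-free, without parallel arcs, and with a symmetric
  arc relation, so an edge \<open>uv\<close> is the pair of arcs \<open>(u, v)\<close> and \<open>(v, u)\<close>.\<close>

definition nbhd :: "'a pair_pre_digraph \<Rightarrow> 'a \<Rightarrow> 'a set" where
  "nbhd G v = {w. (v, w) \<in> parcs G}"

definition super_dominating_set :: "'a pair_pre_digraph \<Rightarrow> 'a set \<Rightarrow> bool" where
  "super_dominating_set G D \<longleftrightarrow> D \<subseteq> pverts G \<and>
     (\<forall>u \<in> pverts G - D. \<exists>v \<in> D. nbhd G v \<inter> (pverts G - D) = {u})"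

definition super_domination_number :: "'a pair_pre_digraph \<Rightarrow> nat" where
  "super_domination_number G = Min {card D | D. super_dominating_set G D}"

definition lex_product ::
    "'a pair_pre_digraph \<Rightarrow> 'b pair_pre_digraph \<Rightarrow> ('a \<times> 'b) pair_pre_digraph" where
  "lex_product G H = \<lparr>
     pverts = pverts G \<times> pverts H,
     parcs = {((g, h), (g', h')).
       (g, h) \<in> pverts G \<times> pverts H \<and> (g', h') \<in> pverts G \<times> pverts H \<and>
       ((g, g') \<in> parcs G \<or> g = g' \<and> (h, h') \<in> parcs H)} \<rparr>"

definition complete_pgraph :: "nat \<Rightarrow> nat pair_pre_digraph" where
  "complete_pgraph m = \<lparr>
     pverts = {0..<m},
     parcs = {(i, j). i \<in> {0..<m} \<and> j \<in> {0..<m} \<and> i \<noteq> j} \<rparr>"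

text \<open>This is the cycle of order \<open>m\<close> only for \<open>m \<ge> 3\<close>.\<close>

definition cycle_pgraph :: "nat \<Rightarrow> nat pair_pre_digraph" where
  "cycle_pgraph m = \<lparr>
     pverts = {0..<m},
     parcs = {(i, j). i \<in> {0..<m} \<and> j \<in> {0..<m} \<and>
       (j = (i + 1) mod m \<or> i = (j + 1) mod m)} \<rparr>"

abbreviation graph_iso :: "'a pair_pre_digraph \<Rightarrow> 'b pair_pre_digraph \<Rightarrow> bool" where
  "graph_iso G H \<equiv> digraph_iso (with_proj G) (with_proj H)"

lemma pair_graphI:
  assumes "finite (pverts G)" "parcs G \<subseteq> pverts G \<times> pverts G" "sym (parcs G)" "irrefl (parcs G)"
  shows "pair_graph G"
proof -
  have "finite (parcs G)"
    using assms(1,2) by (meson finite_SigmaI finite_subset)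
  then show ?thesis
    using assms by unfold_locales (auto simp: symmetric_def irrefl_def)
qed

lemma pair_graph_complete: "pair_graph (complete_pgraph m)"
  by (rule pair_graphI) (auto simp: complete_pgraph_def sym_def irrefl_def)

lemma pair_graph_cycle:
  assumes "m \<ge> 2"
  shows "pair_graph (cycle_pgraph m)"
proof (rule pair_graphI)
  have "i \<noteq> Suc i mod m" if "i < m" for i
    using that assms by (cases "Suc i = m") auto
  then show "irrefl (parcs (cycle_pgraph m))"
    by (fastforce simp: cycle_pgraph_def irrefl_def)
qed (auto simp: cycle_pgraph_def sym_def)

lemma pair_graph_lex_product:
  assumes "pair_graph G" "pair_graph H"
  shows "pair_graph (lex_product G H)"
proof -
  interpret G: pair_graph G by fact
  interpret H: pair_graph H by fact
  show ?thesis
    by (rule pair_graphI)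
      (auto simp: lex_product_def sym_def irrefl_def
        intro: G.arcs_symmetric H.arcs_symmetric dest: G.no_loops' H.no_loops')
qed

lemma super_domination_number_attained:
  assumes "finite (pverts G)"
  shows "\<exists>D. super_dominating_set G D \<and> card D = super_domination_number G"
    and "super_dominating_set G D \<Longrightarrow> super_domination_number G \<le> card D"
proof -
  let ?S = "{card D | D. super_dominating_set G D}"
  have "?S \<subseteq> card ` Pow (pverts G)"
    by (auto simp: super_dominating_set_def)
  then have fin: "finite ?S"
    using assms by (meson finite_Pow_iff finite_imageI finite_subset)
  have "super_dominating_set G (pverts G)"
    by (simp add: super_dominating_set_def)
  then have ne: "?S \<noteq> {}" by blast
  have "Min ?S \<in> ?S" by (rule Min_in[OF fin ne])
  then show "\<exists>D. super_dominating_set G D \<and> card D = super_domination_number G"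
    by (auto simp: super_domination_number_def)
  show "super_dominating_set G D \<Longrightarrow> super_domination_number G \<le> card D"
    unfolding super_domination_number_def by (rule Min_le[OF fin]) blast
qed

lemma graph_iso_iff:
  assumes "pair_graph G" "pair_graph H"
  shows "graph_iso G H \<longleftrightarrow> (\<exists>f. bij_betw f (pverts G) (pverts H) \<and>
    (\<forall>u \<in> pverts G. \<forall>v \<in> pverts G. (u, v) \<in> parcs G \<longleftrightarrow> (f u, f v) \<in> parcs H))"
    (is "_ \<longleftrightarrow> ?R")
proof
  interpret G: pair_graph G by fact
  assume "graph_iso G H"
  then obtain h where h: "G.digraph_isomorphism h" and H: "with_proj H = app_iso h (with_proj G)"
    by (auto simp: digraph_iso_def)
  let ?f = "iso_verts h"
  have inj: "inj_on ?f (pverts G)" and injA: "inj_on (iso_arcs h) (parcs G)"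
    and ends: "\<And>a. a \<in> parcs G \<Longrightarrow> ?f (fst a) = iso_tail h (iso_arcs h a) \<and>
      ?f (snd a) = iso_head h (iso_arcs h a)"
    using h by (auto simp: G.digraph_isomorphism_def)
  have V: "pverts H = ?f ` pverts G" and A: "parcs H = iso_arcs h ` parcs G"
    and t: "iso_tail h = fst" and hd: "iso_head h = snd"
    using arg_cong[OF H, of verts] arg_cong[OF H, of arcs]
      arg_cong[OF H, of tail] arg_cong[OF H, of head] by simp_all
  have arc: "iso_arcs h (u, v) = (?f u, ?f v)" if "(u, v) \<in> parcs G" for u v
    using ends[OF that] t hd by (simp add: prod_eq_iff)
  have "(u, v) \<in> parcs G \<longleftrightarrow> (?f u, ?f v) \<in> parcs H" if "u \<in> pverts G" "v \<in> pverts G" for u v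
  proof
    assume "(u, v) \<in> parcs G"
    then show "(?f u, ?f v) \<in> parcs H" using A arc by (metis imageI)
  next
    assume "(?f u, ?f v) \<in> parcs H"
    then obtain x y where xy: "(x, y) \<in> parcs G" "iso_arcs h (x, y) = (?f u, ?f v)"
      using A by auto
    then have "?f x = ?f u" "?f y = ?f v" using arc by auto
    moreover have "x \<in> pverts G" "y \<in> pverts G" using xy(1) G.wellformed' by auto
    ultimately show "(u, v) \<in> parcs G" using inj that xy(1) by (metis inj_onD)
  qed
  then show ?R using inj V by (auto simp: bij_betw_def)
next
  interpret G: pair_graph G by fact
  interpret H: pair_graph H by fact
  assume ?R
  then obtain f where f: "bij_betw f (pverts G) (pverts H)"
    and e: "\<And>u v. u \<in> pverts G \<Longrightarrow> v \<in> pverts G \<Longrightarrow> (u, v) \<in> parcs G \<longleftrightarrow> (f u, f v) \<in> parcs H"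
    by blast
  let ?h = "\<lparr> iso_verts = f, iso_arcs = map_prod f f, iso_head = snd, iso_tail = fst \<rparr>"
  have inj: "inj_on f (pverts G)" and V: "f ` pverts G = pverts H"
    using f by (auto simp: bij_betw_def)
  have "inj_on (map_prod f f) (parcs G)"
    using inj G.wellformed' by (auto simp: inj_on_def)
  then have "G.digraph_isomorphism ?h"
    using inj by (auto simp: G.digraph_isomorphism_def intro: G.wf_digraph_axioms)
  moreover have "map_prod f f ` parcs G = parcs H"
  proof (intro equalityI subsetI)
    fix a assume "a \<in> map_prod f f ` parcs G"
    then obtain u v where uv: "(u, v) \<in> parcs G" "a = (f u, f v)" by auto
    then show "a \<in> parcs H" using e[OF G.wellformed'[OF uv(1)]] by simp
  next
    fix a assume a: "a \<in> parcs H"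
    obtain x y where xy: "a = (x, y)" by (cases a)
    then have "x \<in> f ` pverts G" "y \<in> f ` pverts G"
      using a H.wellformed' unfolding V by blast+
    then obtain u v where uv: "u \<in> pverts G" "v \<in> pverts G" "x = f u" "y = f v"
      by blast
    then have "(u, v) \<in> parcs G" using e[OF uv(1,2)] a xy by simp
    then show "a \<in> map_prod f f ` parcs G" using xy uv(3,4) by (simp add: rev_image_eqI)
  qed
  then have "with_proj H = app_iso ?h (with_proj G)"
    using V by (simp add: app_iso_def with_proj_def)
  ultimately show "graph_iso G H"
    unfolding digraph_iso_def by blast
qed

end

theory Submission
  imports Defs
begin

text \<open>
  Minimising a super dominating set \<open>D\<close> means maximising its complement \<open>A\<close>, and \<open>A\<close> is the more
  convenient object: every \<open>u \<in> A\<close> needs a vertex outside \<open>A\<close> whose only neighbour in \<open>A\<close> is \<open>u\<close>.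
  In \<open>C\<^sub>n \<circ> H\<close> a vertex sees the two neighbouring copies of \<open>H\<close> completely. So let \<open>F i\<close> be the part of
  \<open>A\<close> in the \<open>i\<close>-th copy and let \<open>v\<close> be the vertex serving \<open>u = (i, h) \<in> A\<close>. If \<open>v\<close> lies in
  copy \<open>i\<close>, both \<open>F (i - 1)\<close> and \<open>F (i + 1)\<close> are empty and \<open>h\<close> is already served inside \<open>H\<close>. If \<open>v\<close>
  lies in copy \<open>i + 1\<close> or \<open>i - 1\<close>, it sees all of \<open>F i\<close> and of \<open>F (i + 2)\<close>, respectively
  \<open>F (i - 2)\<close>, so \<open>F i\<close> is a single vertex and that other part is empty. This is
  \<open>super_dominating_lex_cycle_local\<close>, and everything else is counting \<open>b i = card (F i)\<close> around the
  cycle. Write \<open>m\<close> for the largest size of the complement of a super dominating set of \<open>H\<close>. Then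
  \<open>b i \<ge> 2\<close> forces \<open>b i \<le> m\<close> and two empty neighbouring copies.

  For \<open>m = 1\<close> all \<open>b i\<close> are 0 or 1, and every copy with a 1 has an empty copy at distance two on
  one side or empty neighbours on both sides. A charging argument
  (\<open>three_times_sum_le_of_local_zeros\<close>) then gives at most twice as many ones as zeros, hence
  \<open>card A \<le> 2 * n div 3\<close>. The periodic pattern \<open>1 1 0\<close>, with one fixed vertex \<open>x\<close> in each chosen copy,
  attains the bound: in a pair of adjacent chosen copies, each \<open>x\<close> is served from the other copy by a
  non-neighbour of \<open>x\<close>, and such a vertex exists for some \<open>x\<close> as \<open>H\<close> is not complete.

  For \<open>m \<ge> 2\<close> any two consecutive copies satisfy \<open>b i + b (i + 1) \<le> m\<close>, and some copy is empty. For
  odd \<open>n\<close> one drops the empty copy and pairs up the others, so \<open>card A \<le> (n div 2) * m\<close> in either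
  parity. Putting an optimal complement of \<open>H\<close> into every second copy attains this bound.
\<close>

section \<open>Super domination through complements\<close>

lemma super_dominating_compl_iff:
  assumes "A \<subseteq> pverts G"
  shows "super_dominating_set G (pverts G - A) \<longleftrightarrow>
    (\<forall>u \<in> A. \<exists>v \<in> pverts G - A. nbhd G v \<inter> A = {u})"
proof -
  have "pverts G - (pverts G - A) = A" using assms by blast
  then show ?thesis by (simp add: super_dominating_set_def)
qed

lemma card_le_of_super_dominating_compl:
  assumes "finite (pverts G)" "A \<subseteq> pverts G" "super_dominating_set G (pverts G - A)"
  shows "super_domination_number G + card A \<le> card (pverts G)"
proof -
  have "super_domination_number G \<le> card (pverts G - A)"
    by (rule super_domination_number_attained(2)[OF assms(1,3)])
  moreover have "card (pverts G - A) + card A = card (pverts G)"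
    by (metis add.commute assms(1,2) card_Diff_subset card_mono finite_subset le_add_diff_inverse)
  ultimately show ?thesis by linarith
qed

lemma super_dominating_compl_attained:
  assumes "finite (pverts G)"
  obtains A where "A \<subseteq> pverts G" "super_dominating_set G (pverts G - A)"
    "super_domination_number G + card A = card (pverts G)"
proof -
  obtain D where D: "super_dominating_set G D" "card D = super_domination_number G"
    using super_domination_number_attained(1)[OF assms] by blast
  have sub: "D \<subseteq> pverts G" using D(1) by (simp add: super_dominating_set_def)
  have "pverts G - (pverts G - D) = D" using sub by blast
  moreover have "card D + card (pverts G - D) = card (pverts G)"
    using assms sub by (metis card_Diff_subset card_mono finite_subset le_add_diff_inverse)
  ultimately show thesis using that[of "pverts G - D"] D by auto
qed

lemma super_domination_number_eqI:
  assumes "finite (pverts G)" "A \<subseteq> pverts G" "super_dominating_set G (pverts G - A)"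
    and max: "\<And>B. B \<subseteq> pverts G \<Longrightarrow> super_dominating_set G (pverts G - B) \<Longrightarrow> card B \<le> card A"
  shows "super_domination_number G + card A = card (pverts G)"
proof -
  obtain B where "B \<subseteq> pverts G" "super_dominating_set G (pverts G - B)"
    "super_domination_number G + card B = card (pverts G)"
    using super_dominating_compl_attained[OF assms(1)] .
  then show ?thesis
    using max[of B] card_le_of_super_dominating_compl[OF assms(1-3)] by linarith
qed

section \<open>Sums and counting for periodic sequences\<close>

lemma sum_periodic_shift:
  fixes f :: "nat \<Rightarrow> nat"
  assumes "\<And>i. f (i + n) = f i"
  shows "(\<Sum>i<n. f (i + k)) = (\<Sum>i<n. f i)"
proof (induction k)
  case (Suc k)
  let ?g = "\<lambda>i. f (i + k)"
  have "?g 0 + (\<Sum>i<n. ?g (Suc i)) = (\<Sum>i<n. ?g i) + ?g n"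
    using sum.lessThan_Suc[of ?g n] sum.lessThan_Suc_shift[of ?g n] by simp
  moreover have "?g n = ?g 0" using assms[of k] by (simp add: add.commute)
  ultimately show ?case using Suc by simp
qed simp

text \<open>Discharging: each one at position \<open>p\<close> gives charge to a zero at \<open>p - 2\<close> or \<open>p + 2\<close>, or else half a
  charge to each of the zeros \<open>p - 1\<close> and \<open>p + 1\<close>. From its right, a zero receives either 1 from
  distance two or, only if that place is a zero, 1/2 from distance one; likewise from its left. So no
  zero receives more than 2, and the ones number at most twice the zeros.\<close>

lemma three_times_sum_le_of_local_zeros:
  fixes b :: "nat \<Rightarrow> nat"
  assumes per: "\<And>i. b (i + n) = b i"
    and le1: "\<And>i. b i \<le> 1"
    and loc: "\<And>i. b (i + 2) > 0 \<Longrightarrow>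
      b i = 0 \<or> b (i + 4) = 0 \<or> b (i + 1) = 0 \<and> b (i + 3) = 0"
  shows "3 * (\<Sum>i<n. b i) \<le> 2 * n"
proof -
  \<comment> \<open>\<open>z\<close> marks zeros; \<open>c\<close>, \<open>d\<close> mark the patterns \<open>0 _ 1\<close> and \<open>1 _ 0\<close>, and \<open>e\<close> the pattern \<open>0 1 0\<close>,
      each indexed by its left end.\<close>
  define z where "z i = 1 - b i" for i
  define c where "c i = z i * b (i + 2)" for i
  define d where "d i = b i * z (i + 2)" for i
  define e where "e i = z i * b (i + 1) * z (i + 2)" for i
  have per': "b (Suc (i + n)) = b (Suc i)" "b (Suc (Suc (i + n))) = b (Suc (Suc i))" for i
    using per[of "Suc i"] per[of "Suc (Suc i)"] by simp_all
  have shift: "(\<Sum>i<n. b (i + k)) = (\<Sum>i<n. b i)" "(\<Sum>i<n. z (i + k)) = (\<Sum>i<n. z i)"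
    "(\<Sum>i<n. c (i + k)) = (\<Sum>i<n. c i)" "(\<Sum>i<n. d (i + k)) = (\<Sum>i<n. d i)"
    "(\<Sum>i<n. e (i + k)) = (\<Sum>i<n. e i)" for k
    by (rule sum_periodic_shift; simp add: per per' z_def c_def d_def e_def)+
  have b01: "b i = 0 \<or> b i = 1" for i using le1[of i] by linarith
  have "b (i + 2) \<le> c i + d (i + 2) + e (i + 1)" for i
    using loc[of i] b01[of i] b01[of "i + 1"] b01[of "i + 2"] b01[of "i + 3"] b01[of "i + 4"]
    by (auto simp: c_def d_def e_def z_def numeral_eq_Suc)
  then have "(\<Sum>i<n. b (i + 2)) \<le> (\<Sum>i<n. c i + d (i + 2) + e (i + 1))"
    by (intro sum_mono)
  then have ones: "(\<Sum>i<n. b i) \<le> (\<Sum>i<n. c i) + (\<Sum>i<n. d i) + (\<Sum>i<n. e i)"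
    by (simp only: sum.distrib shift)
  \<comment> \<open>The charge received by position \<open>i + 2\<close>, doubled to stay in the naturals.\<close>
  have "2 * c (i + 2) + 2 * d i + e (i + 2) + e i \<le> 4 * z (i + 2)" for i
    using b01[of i] b01[of "i + 1"] b01[of "i + 2"] b01[of "i + 3"] b01[of "i + 4"]
    by (auto simp: c_def d_def e_def z_def numeral_eq_Suc)
  then have "(\<Sum>i<n. 2 * c (i + 2) + 2 * d i + e (i + 2) + e i) \<le> (\<Sum>i<n. 4 * z (i + 2))"
    by (intro sum_mono)
  then have zeros: "2 * (\<Sum>i<n. c i) + 2 * (\<Sum>i<n. d i) + (\<Sum>i<n. e i) + (\<Sum>i<n. e i)
      \<le> 4 * (\<Sum>i<n. z i)"
    by (simp only: sum.distrib sum_distrib_left[symmetric] shift)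
  have "b i + z i = 1" for i using le1[of i] by (simp add: z_def)
  then have "(\<Sum>i<n. b i) + (\<Sum>i<n. z i) = n"
    by (simp add: sum.distrib[symmetric])
  then show ?thesis using ones zeros by linarith
qed

lemma sum_le_of_consecutive_pairs:
  fixes g :: "nat \<Rightarrow> nat"
  assumes "\<And>i. g i + g (Suc i) \<le> m"
  shows "(\<Sum>i<2 * q. g i) \<le> q * m"
proof (induction q)
  case (Suc q)
  then show ?case using assms[of "2 * q"] by simp
qed simp

text \<open>For odd \<open>n\<close> the rotation that moves the zero to the front leaves an even number of terms to pair
  up; without a zero the floor in \<open>n div 2\<close> would be wrong.\<close>

lemma periodic_sum_le_of_consecutive_pairs:
  fixes b :: "nat \<Rightarrow> nat"
  assumes per: "\<And>i. b (i + n) = b i"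
    and pair: "\<And>i. b i + b (Suc i) \<le> m"
    and zero: "b k = 0"
  shows "(\<Sum>i<n. b i) \<le> n div 2 * m"
proof (cases "even n")
  case True
  then show ?thesis using sum_le_of_consecutive_pairs[of b m "n div 2"] pair by simp
next
  case False
  define q where "q = n div 2"
  have n: "n = Suc (2 * q)" using False by (simp add: q_def)
  have "(\<Sum>i<n. b i) = (\<Sum>i<n. b (i + k))" using sum_periodic_shift[of b n k] per by simp
  also have "\<dots> = b k + (\<Sum>i<2 * q. b (Suc i + k))"
    by (simp only: n sum.lessThan_Suc_shift) simp
  also have "\<dots> \<le> q * m"
    using sum_le_of_consecutive_pairs[of "\<lambda>i. b (Suc i + k)" m q] pair zero by simp
  finally show ?thesis by (simp add: q_def)
qed

section \<open>Fibres of the lexicographic product over a cycle\<close>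

text \<open>The index is reduced modulo \<open>n\<close>, so that fibres form a periodic sequence over all natural numbers
  and the cyclic neighbours of position \<open>i + 2\<close> are \<open>i + 1\<close> and \<open>i + 3\<close>, with no truncated subtraction.\<close>

definition fibre :: "nat \<Rightarrow> (nat \<times> 'a) set \<Rightarrow> nat \<Rightarrow> 'a set" where
  "fibre n A i = {h. (i mod n, h) \<in> A}"

lemma fibre_periodic: "fibre n A (i + n) = fibre n A i"
  by (simp add: fibre_def)

lemma card_eq_sum_fibres:
  assumes "A \<subseteq> {0..<n} \<times> V" "finite V"
  shows "card A = (\<Sum>i<n. card (fibre n A i))"
proof -
  have "A = Sigma {..<n} (fibre n A)" using assms(1) by (fastforce simp: fibre_def)
  moreover have "finite (fibre n A i)" for i
    using assms by (auto simp: fibre_def intro: finite_subset[of _ V])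
  ultimately show ?thesis using card_SigmaI[of "{..<n}" "fibre n A"] by simp
qed

lemma mod_step_neq:
  assumes "n \<ge> 3"
  shows "Suc i mod n \<noteq> i mod n" "(i + 2) mod n \<noteq> i mod n"
  using assms by (auto simp: mod_Suc numeral_eq_Suc)

lemma cycle_adjacent_iff:
  assumes "n \<ge> 1"
  shows "(Suc i mod n, j) \<in> parcs (cycle_pgraph n) \<longleftrightarrow> j = i mod n \<or> j = (i + 2) mod n"
proof -
  have "j = (Suc i mod n + 1) mod n \<longleftrightarrow> j = (i + 2) mod n" by (simp add: mod_simps)
  moreover have "j < n \<Longrightarrow> Suc i mod n = (j + 1) mod n \<longleftrightarrow> j = i mod n"
    using assms by (auto simp: mod_Suc split: if_splits)
  ultimately show ?thesis using assms by (auto simp: cycle_pgraph_def)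
qed

lemma pverts_lex_cycle: "pverts (lex_product (cycle_pgraph n) H) = {0..<n} \<times> pverts H"
  by (simp add: lex_product_def cycle_pgraph_def)

lemma nbhd_lex_cycle_Int:
  assumes "n \<ge> 1" "pair_graph H" "A \<subseteq> {0..<n} \<times> pverts H" "k \<in> pverts H"
  shows "nbhd (lex_product (cycle_pgraph n) H) (Suc i mod n, k) \<inter> A =
    {i mod n} \<times> fibre n A i \<union> {(i + 2) mod n} \<times> fibre n A (i + 2) \<union>
    {Suc i mod n} \<times> (nbhd H k \<inter> fibre n A (Suc i))"
proof -
  have "(g, h) \<in> nbhd (lex_product (cycle_pgraph n) H) (Suc i mod n, k) \<longleftrightarrow>
      g = i mod n \<or> g = (i + 2) mod n \<or> g = Suc i mod n \<and> h \<in> nbhd H k" if "(g, h) \<in> A" for g h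
    using that assms cycle_adjacent_iff[OF assms(1), of i g]
    by (auto simp: nbhd_def lex_product_def cycle_pgraph_def)
  then show ?thesis by (auto simp: fibre_def)
qed

text \<open>The alternatives record in which copy the vertex serving \<open>h\<close> lies: in the copy \<open>i + 2\<close> of \<open>h\<close>
  itself, or next to it. In the latter case it is adjacent to the whole copies on both of its sides, so
  \<open>h\<close> must be alone in its fibre and the fibre on the far side must be empty. For \<open>n \<ge> 3\<close> these two
  copies are distinct.\<close>

lemma super_dominating_lex_cycle_local:
  fixes H :: "'a pair_pre_digraph"
  assumes n: "n \<ge> 3" and H: "pair_graph H"
    and A: "A \<subseteq> pverts (lex_product (cycle_pgraph n) H)"
    and D: "super_dominating_set (lex_product (cycle_pgraph n) H)
      (pverts (lex_product (cycle_pgraph n) H) - A)"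
    and h: "h \<in> fibre n A (i + 2)"
  shows "fibre n A (i + 1) = {} \<and> fibre n A (i + 3) = {} \<and>
      (\<exists>k \<in> pverts H - fibre n A (i + 2). nbhd H k \<inter> fibre n A (i + 2) = {h}) \<or>
    fibre n A (i + 2) = {h} \<and> (fibre n A i = {} \<or> fibre n A (i + 4) = {})"
proof -
  let ?P = "lex_product (cycle_pgraph n) H" and ?F = "fibre n A"
  have A': "A \<subseteq> {0..<n} \<times> pverts H" using A by (simp add: pverts_lex_cycle)
  have u: "((i + 2) mod n, h) \<in> A" using h by (simp add: fibre_def)
  then obtain j k where jk: "(j, k) \<in> pverts ?P - A" "nbhd ?P (j, k) \<inter> A = {((i + 2) mod n, h)}"
    using D unfolding super_dominating_compl_iff[OF A] by fast
  have k: "k \<in> pverts H" using jk(1) by (simp add: pverts_lex_cycle)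
  have mem: "g = (i + 2) mod n \<and> x = h \<longleftrightarrow>
      g = a mod n \<and> x \<in> ?F a \<or> g = (a + 2) mod n \<and> x \<in> ?F (a + 2) \<or>
      g = Suc a mod n \<and> x \<in> nbhd H k \<inter> ?F (Suc a)" if "j = Suc a mod n" for a g x
    using jk(2) nbhd_lex_cycle_Int[OF _ H A' k, of a] n unfolding that by (simp add: set_eq_iff)
  have "(j, (i + 2) mod n) \<in> parcs (cycle_pgraph n) \<or> j = (i + 2) mod n"
    using jk(2) by (auto simp: nbhd_def lex_product_def)
  moreover have "(Suc (i + 1) mod n, j) \<in> parcs (cycle_pgraph n)"
    if "(j, (i + 2) mod n) \<in> parcs (cycle_pgraph n)"
    using that by (auto simp: cycle_pgraph_def)
  ultimately consider (own) "j = Suc (i + 1) mod n" | (left) "j = Suc i mod n"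
    | (right) "j = Suc (i + 2) mod n"
    using cycle_adjacent_iff[of n "i + 1" j] n by (auto simp: numeral_eq_Suc)
  then show ?thesis
  proof cases
    case own
    have "k \<notin> ?F (i + 2)" using jk(1) own by (auto simp: fibre_def)
    moreover have "(i + 2) mod n \<noteq> (i + 1) mod n" "(i + 3) mod n \<noteq> (i + 2) mod n"
      using mod_step_neq(1)[OF n, of "i + 1"] mod_step_neq(1)[OF n, of "i + 2"]
      by (simp_all add: numeral_eq_Suc)
    then have "?F (i + 1) = {}" "?F (i + 3) = {}" "nbhd H k \<inter> ?F (i + 2) = {h}"
      using mem[OF own, of "(i + 1) mod n"] mem[OF own, of "(i + 3) mod n"]
        mem[OF own, of "(i + 2) mod n"]
      by (auto simp: numeral_eq_Suc)
    ultimately show ?thesis using k by blast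
  next
    case left
    have "(i + 2) mod n \<noteq> Suc i mod n"
      using mod_step_neq(1)[OF n, of "Suc i"] by simp
    then have "?F i = {}" "?F (i + 2) = {h}"
      using mem[OF left, of "i mod n"] mem[OF left, of "(i + 2) mod n"] mod_step_neq[OF n, of i]
      by auto
    then show ?thesis by blast
  next
    case right
    have "(i + 4) mod n \<noteq> (i + 2) mod n" "Suc (i + 2) mod n \<noteq> (i + 2) mod n"
      using mod_step_neq[OF n, of "i + 2"] by (simp_all add: numeral_eq_Suc)
    then have "?F (i + 4) = {}" "?F (i + 2) = {h}"
      using mem[OF right, of "(i + 4) mod n"] mem[OF right, of "(i + 2) mod n"]
      by (auto simp: numeral_eq_Suc)
    then show ?thesis by blast
  qed
qed

text \<open>A fibre with at least two elements cannot be served from a neighbouring copy, so it is served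
  from within and is itself the complement of a super dominating set of \<open>H\<close>.\<close>

lemma super_dominating_lex_cycle_card_fibres:
  fixes H :: "'a pair_pre_digraph"
  assumes n: "n \<ge> 3" and H: "pair_graph H"
    and A: "A \<subseteq> pverts (lex_product (cycle_pgraph n) H)"
    and D: "super_dominating_set (lex_product (cycle_pgraph n) H)
      (pverts (lex_product (cycle_pgraph n) H) - A)"
  defines "b \<equiv> \<lambda>i. card (fibre n A i)"
  shows "b (i + 2) > 0 \<Longrightarrow> b i = 0 \<or> b (i + 4) = 0 \<or> b (i + 1) = 0 \<and> b (i + 3) = 0"
    and "b i \<ge> 2 \<Longrightarrow> b (i + 1) = 0 \<and> super_domination_number H + b i \<le> card (pverts H)"
    and "b (i + 1) \<ge> 2 \<Longrightarrow> b i = 0"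
proof -
  interpret H: pair_graph H by fact
  let ?F = "fibre n A"
  have A': "A \<subseteq> {0..<n} \<times> pverts H" using A by (simp add: pverts_lex_cycle)
  have sub: "?F i \<subseteq> pverts H" for i using A' by (auto simp: fibre_def)
  have fin: "finite (?F i)" for i using sub[of i] by (rule finite_subset) simp
  have b0: "b i = 0 \<longleftrightarrow> ?F i = {}" for i using fin by (simp add: b_def)
  have per: "b (i + n) = b i" for i by (simp add: b_def fibre_periodic)
  note loc = super_dominating_lex_cycle_local[OF n H A D]
  show "b i = 0 \<or> b (i + 4) = 0 \<or> b (i + 1) = 0 \<and> b (i + 3) = 0" if "b (i + 2) > 0"
    using that loc[of _ i] by (metis b0 ex_in_conv less_nat_zero_code)
  have big: "b (i + 1) = 0 \<and> b (i + 3) = 0 \<and> super_domination_number H + b (i + 2) \<le> card (pverts H)"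
    if "b (i + 2) \<ge> 2" for i
  proof -
    have ns: "?F (i + 2) \<noteq> {h}" for h using that by (auto simp: b_def)
    have "super_dominating_set H (pverts H - ?F (i + 2))"
      unfolding super_dominating_compl_iff[OF sub] using loc[of _ i] ns by blast
    moreover have "?F (i + 1) = {}" "?F (i + 3) = {}"
      using loc[of _ i] ns that b0[of "i + 2"] by fastforce+
    ultimately show ?thesis
      using card_le_of_super_dominating_compl[OF _ sub] b0 by (simp add: b_def)
  qed
  \<comment> \<open>Position \<open>i\<close> is one turn around the cycle from \<open>(i + n - 2) + 2\<close>, which has the form that
      \<open>big\<close> needs.\<close>
  have *: "b (i + n - 2 + 2) = b i" "b (i + n - 2 + 3) = b (i + 1)"
    "b (i + n - 1 + 1) = b i" "b (i + n - 1 + 2) = b (i + 1)"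
  proof -
    have "i + n - 2 + 2 = i + n" "i + n - 2 + 3 = i + 1 + n"
      "i + n - 1 + 1 = i + n" "i + n - 1 + 2 = i + 1 + n"
      using n by simp_all
    then show "b (i + n - 2 + 2) = b i" "b (i + n - 2 + 3) = b (i + 1)"
      "b (i + n - 1 + 1) = b i" "b (i + n - 1 + 2) = b (i + 1)"
      by (simp_all only: per)
  qed
  show "b (i + 1) = 0 \<and> super_domination_number H + b i \<le> card (pverts H)" if "b i \<ge> 2"
    using big[of "i + n - 2"] that * by simp
  show "b i = 0" if "b (i + 1) \<ge> 2"
    using big[of "i + n - 1"] that * by simp
qed

section \<open>Graphs whose super domination number is one below the order\<close>

lemma lex_cycle_compl_le_two_thirds:
  fixes H :: "'a pair_pre_digraph"
  assumes n: "n \<ge> 3" and H: "pair_graph H"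
    and gamma: "super_domination_number H + 1 = card (pverts H)"
    and A: "A \<subseteq> pverts (lex_product (cycle_pgraph n) H)"
    and D: "super_dominating_set (lex_product (cycle_pgraph n) H)
      (pverts (lex_product (cycle_pgraph n) H) - A)"
  shows "card A \<le> 2 * n div 3"
proof -
  interpret H: pair_graph H by fact
  note fib = super_dominating_lex_cycle_card_fibres[OF n H A D]
  have "card (fibre n A i) \<le> 1" for i using fib(2)[of i] gamma by linarith
  then have "3 * (\<Sum>i<n. card (fibre n A i)) \<le> 2 * n"
    by (intro three_times_sum_le_of_local_zeros) (use fib(1) in \<open>auto simp: fibre_periodic\<close>)
  then show ?thesis using card_eq_sum_fibres[of A n "pverts H"] A by (simp add: pverts_lex_cycle)
qed

lemma card_not_two_mod_three: "card {i. i < N \<and> i mod 3 \<noteq> (2::nat)} = (2 * N + 2) div 3"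
proof (induction N)
  case (Suc N)
  have "{i. i < Suc N \<and> i mod 3 \<noteq> 2} =
      (if N mod 3 = 2 then {} else {N}) \<union> {i. i < N \<and> i mod 3 \<noteq> 2}"
    by (auto simp: less_Suc_eq)
  then have "card {i. i < Suc N \<and> i mod 3 \<noteq> 2} =
      (if N mod 3 = 2 then 0 else 1) + card {i. i < N \<and> i mod 3 \<noteq> 2}"
    by (auto simp: card_insert_if)
  moreover have "(2 * Suc N + 2) div 3 = (if N mod 3 = 2 then 0 else 1) + (2 * N + 2) div 3"
    by (cases "N mod 3 = 2") (simp_all, presburger+)
  ultimately show ?case using Suc by (simp only:)
qed simp

text \<open>In a graph that is not complete some vertex has a non-neighbour. If that vertex is isolated, an
  end of any edge serves instead, with the isolated vertex as its non-neighbour.\<close>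

lemma exists_mixed_vertex:
  assumes H: "pair_graph H" and ne: "parcs H \<noteq> {}"
    and nc: "\<not> graph_iso H (complete_pgraph (card (pverts H)))"
  obtains x y z where "x \<in> pverts H" "y \<in> pverts H" "z \<in> pverts H"
    "x \<noteq> y" "(y, x) \<notin> parcs H" "(z, x) \<in> parcs H"
proof -
  interpret H: pair_graph H by fact
  obtain a c where ac: "(a, c) \<in> parcs H" using ne by auto
  have ac': "a \<in> pverts H" "c \<in> pverts H" "(c, a) \<in> parcs H"
    using ac H.wellformed' H.arcs_symmetric by auto
  have "\<exists>x\<in>pverts H. \<exists>y\<in>pverts H. x \<noteq> y \<and> (x, y) \<notin> parcs H"
  proof (rule ccontr)
    assume contra: "\<not> ?thesis"
    obtain f where f: "bij_betw f (pverts H) {0..<card (pverts H)}"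
      using ex_bij_betw_finite_nat[of "pverts H"] by auto
    have "(u, v) \<in> parcs H \<longleftrightarrow> (f u, f v) \<in> parcs (complete_pgraph (card (pverts H)))"
      if "u \<in> pverts H" "v \<in> pverts H" for u v
    proof -
      have "(u, v) \<in> parcs H \<longleftrightarrow> u \<noteq> v" using contra that H.no_loops' by blast
      also have "\<dots> \<longleftrightarrow> f u \<noteq> f v" using f that by (auto simp: bij_betw_def inj_on_def)
      finally show ?thesis using bij_betwE[OF f] that by (auto simp: complete_pgraph_def)
    qed
    then show False
      using nc f unfolding graph_iso_iff[OF H pair_graph_complete]
      by (auto simp: complete_pgraph_def)
  qed
  then obtain x y where xy: "x \<in> pverts H" "y \<in> pverts H" "x \<noteq> y" "(x, y) \<notin> parcs H" by blast
  show thesis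
  proof (cases "\<exists>z. (z, x) \<in> parcs H")
    case True
    then show thesis using that[of x y] xy H.arcs_symmetric H.wellformed' by blast
  next
    case False
    then show thesis using that[of a x c] ac ac' xy H.arcs_symmetric by blast
  qed
qed

text \<open>The chosen copies follow the pattern \<open>1 1 0\<close>, with the last copy always left out. A chosen copy
  whose partner is chosen too is served from the partner by the non-neighbour \<open>y\<close> of \<open>x\<close>. For
  \<open>n mod 3 = 2\<close> the copy \<open>n - 2\<close> is chosen without a partner; both neighbouring copies are then empty
  and the neighbour \<open>z\<close> of \<open>x\<close> serves it from within.\<close>

lemma lex_cycle_compl_two_thirds:
  fixes H :: "'a pair_pre_digraph"
  assumes n: "n \<ge> 3" and H: "pair_graph H" and ne: "parcs H \<noteq> {}"
    and nc: "\<not> graph_iso H (complete_pgraph (card (pverts H)))"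
  obtains A where "A \<subseteq> pverts (lex_product (cycle_pgraph n) H)"
    "super_dominating_set (lex_product (cycle_pgraph n) H)
      (pverts (lex_product (cycle_pgraph n) H) - A)"
    "card A = 2 * n div 3"
proof -
  let ?P = "lex_product (cycle_pgraph n) H"
  obtain x y z where xyz: "x \<in> pverts H" "y \<in> pverts H" "z \<in> pverts H"
    "x \<noteq> y" "(y, x) \<notin> parcs H" "(z, x) \<in> parcs H"
    using exists_mixed_vertex[OF H ne nc] .
  interpret H: pair_graph H by fact
  have zx: "z \<noteq> x" using xyz(6) H.no_loops' by blast
  define S where "S = {i. i < n - 1 \<and> i mod 3 \<noteq> 2}"
  define A where "A = S \<times> {x}"
  have A': "A \<subseteq> {0..<n} \<times> pverts H" using xyz by (auto simp: A_def S_def)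
  then have A: "A \<subseteq> pverts ?P" by (simp add: pverts_lex_cycle)
  have F: "fibre n A i = (if i mod n \<in> S then {x} else {})" for i
    by (auto simp: A_def fibre_def)
  have nb: "nbhd ?P (Suc a mod n, k) \<inter> A = {a mod n} \<times> fibre n A a \<union>
    {(a + 2) mod n} \<times> fibre n A (a + 2) \<union> {Suc a mod n} \<times> (nbhd H k \<inter> fibre n A (Suc a))"
    if "k \<in> pverts H" for a k
    using nbhd_lex_cycle_Int[OF _ H A' that] n by simp
  have "\<exists>v \<in> pverts ?P - A. nbhd ?P v \<inter> A = {(i, x)}" if i: "i \<in> S" for i
  proof -
    have in_: "Suc i < n" "i < n" using i n by (auto simp: S_def)
    consider (right) "i mod 3 = 0" "Suc (Suc i) < n" | (last) "i mod 3 = 0" "Suc (Suc i) = n"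
      | (left) "i mod 3 = 1"
      using i in_ by (simp add: S_def) linarith
    then show ?thesis
    proof cases
      case right
      have "(i + 2) mod 3 = 2" using right(1) by presburger
      then have "(i + 2) mod n \<notin> S" using right(2) by (simp add: S_def)
      then have "nbhd ?P (Suc i mod n, y) \<inter> A = {(i, x)}"
        using nb[OF xyz(2), of i] i in_ xyz by (auto simp: F nbhd_def)
      moreover have "(Suc i mod n, y) \<in> pverts ?P - A"
        using in_ xyz by (auto simp: pverts_lex_cycle A_def)
      ultimately show ?thesis by blast
    next
      case last
      obtain j where j: "i = Suc j" using last n by (cases i) auto
      have "j mod 3 = 2" using last(1) j by presburger
      then have "j mod n \<notin> S" using j in_ by (simp add: S_def)
      moreover have "(j + 2) mod n \<notin> S" using j last by (simp add: S_def)
      ultimately have "nbhd ?P (Suc j mod n, z) \<inter> A = {(i, x)}"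
        using nb[OF xyz(3), of j] i in_ xyz j by (auto simp: F nbhd_def)
      moreover have "(Suc j mod n, z) \<in> pverts ?P - A"
        using in_ xyz zx j by (auto simp: pverts_lex_cycle A_def)
      ultimately show ?thesis by blast
    next
      case left
      \<comment> \<open>The copy before the partner, which for \<open>i = 1\<close> is the omitted copy \<open>n - 1\<close>.\<close>
      obtain a where a: "Suc a mod n = i - 1" "a mod n \<notin> S" "(a + 2) mod n = i"
      proof (cases "i = 1")
        case True
        moreover have "Suc n mod n = 1" using n by (simp add: mod_Suc)
        ultimately show thesis using that[of "n - 1"] n by (simp add: S_def)
      next
        case False
        obtain j where j: "i = j + 2"
          using left False
          by (metis One_nat_def add.commute add_2_eq_Suc' mod_0 not0_implies_Suc zero_neq_one)
        have "j mod 3 = 2" using left j by presburger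
        then show thesis using that[of j] in_ j by (simp add: S_def)
      qed
      have "nbhd ?P (Suc a mod n, y) \<inter> A = {(i, x)}"
        using nb[OF xyz(2), of a] i a xyz by (auto simp: F nbhd_def)
      moreover have "(Suc a mod n, y) \<in> pverts ?P - A"
        using in_ xyz n by (auto simp: pverts_lex_cycle A_def)
      ultimately show ?thesis by blast
    qed
  qed
  then have "super_dominating_set ?P (pverts ?P - A)"
    unfolding super_dominating_compl_iff[OF A] by (auto simp: A_def)
  moreover have "card A = 2 * n div 3"
  proof -
    have "card S = (2 * (n - 1) + 2) div 3" unfolding S_def by (rule card_not_two_mod_three)
    moreover have "2 * (n - 1) + 2 = 2 * n" using n by simp
    ultimately show ?thesis by (simp add: A_def card_cartesian_product)
  qed
  ultimately show thesis using that A by blast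
qed

section \<open>Graphs whose super domination number is further below the order\<close>

text \<open>Two nonempty consecutive fibres have one element each, so their sum is \<open>2 \<le> m\<close>; this is where
  \<open>m \<ge> 2\<close> enters. Some fibre is empty because a nonempty one forces an empty one within distance two.\<close>

lemma lex_cycle_compl_le_half:
  fixes H :: "'a pair_pre_digraph"
  assumes n: "n \<ge> 3" and H: "pair_graph H"
    and m: "super_domination_number H + m = card (pverts H)" "m \<ge> 2"
    and A: "A \<subseteq> pverts (lex_product (cycle_pgraph n) H)"
    and D: "super_dominating_set (lex_product (cycle_pgraph n) H)
      (pverts (lex_product (cycle_pgraph n) H) - A)"
  shows "card A \<le> n div 2 * m"
proof -
  interpret H: pair_graph H by fact
  let ?b = "\<lambda>i. card (fibre n A i)"
  note fib = super_dominating_lex_cycle_card_fibres[OF n H A D]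
  have pair: "?b i + ?b (Suc i) \<le> m" for i
    using fib(2)[of i] fib(2)[of "Suc i"] fib(3)[of i] m
    by (cases "?b i \<ge> 2"; cases "?b (Suc i) \<ge> 2") auto
  obtain k where zero: "?b k = 0" using fib(1)[of 0] by (metis gr0I)
  have "(\<Sum>i<n. ?b i) \<le> n div 2 * m"
    by (rule periodic_sum_le_of_consecutive_pairs[OF _ pair zero]) (simp add: fibre_periodic)
  then show ?thesis using card_eq_sum_fibres[of A n "pverts H"] A by (simp add: pverts_lex_cycle)
qed

lemma card_odd_below: "card {i. i < N \<and> odd (i::nat)} = N div 2"
proof (induction N)
  case (Suc N)
  have "{i. i < Suc N \<and> odd i} = (if odd N then {N} else {}) \<union> {i. i < N \<and> odd i}"
    by (auto simp: less_Suc_eq)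
  then have "card {i. i < Suc N \<and> odd i} = (if odd N then 1 else 0) + card {i. i < N \<and> odd i}"
    by (auto simp: card_insert_if)
  then show ?case using Suc by presburger
qed simp

text \<open>Choosing the odd positions below \<open>n\<close> gives \<open>n div 2\<close> pairwise non-adjacent copies, also across
  the end of the cycle as position 0 is not chosen. Hence in each chosen copy the situation is the one
  in \<open>H\<close>.\<close>

lemma lex_cycle_compl_half:
  fixes H :: "'a pair_pre_digraph"
  assumes n: "n \<ge> 3" and H: "pair_graph H"
    and m: "super_domination_number H + m = card (pverts H)"
  obtains A where "A \<subseteq> pverts (lex_product (cycle_pgraph n) H)"
    "super_dominating_set (lex_product (cycle_pgraph n) H)
      (pverts (lex_product (cycle_pgraph n) H) - A)"
    "card A = n div 2 * m"
proof -
  let ?P = "lex_product (cycle_pgraph n) H"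
  interpret H: pair_graph H by fact
  obtain E where E: "E \<subseteq> pverts H" "super_dominating_set H (pverts H - E)"
    "super_domination_number H + card E = card (pverts H)"
    using super_dominating_compl_attained[of H] by auto
  define S where "S = {i. i < n \<and> odd i}"
  define A where "A = S \<times> E"
  have A': "A \<subseteq> {0..<n} \<times> pverts H" using E by (auto simp: A_def S_def)
  then have A: "A \<subseteq> pverts ?P" by (simp add: pverts_lex_cycle)
  have F: "fibre n A i = (if i mod n \<in> S then E else {})" for i
    by (auto simp: A_def fibre_def)
  have "\<exists>v \<in> pverts ?P - A. nbhd ?P v \<inter> A = {(i, h)}" if i: "i \<in> S" and h: "h \<in> E" for i h
  proof -
    obtain k where k: "k \<in> pverts H - E" "nbhd H k \<inter> E = {h}"
      using E(2) h unfolding super_dominating_compl_iff[OF E(1)] by blast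
    obtain j where j: "i = Suc j" using i by (cases i) (auto simp: S_def)
    have ij: "Suc j < n" "even j" using i j by (auto simp: S_def)
    have "j mod n \<notin> S" using ij by (simp add: S_def)
    moreover have "(j + 2) mod n \<notin> S"
      using ij by (cases "j + 2 = n") (auto simp: S_def)
    ultimately have "nbhd ?P (Suc j mod n, k) \<inter> A = {(i, h)}"
      using nbhd_lex_cycle_Int[OF _ H A', of k j] n k i ij j by (auto simp: F)
    moreover have "(Suc j mod n, k) \<in> pverts ?P - A"
      using ij k by (auto simp: pverts_lex_cycle A_def)
    ultimately show ?thesis by blast
  qed
  then have "super_dominating_set ?P (pverts ?P - A)"
    unfolding super_dominating_compl_iff[OF A] by (auto simp: A_def)
  moreover have "card A = n div 2 * m"
    using m E(3) card_odd_below[of n] by (simp add: A_def S_def card_cartesian_product)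
  ultimately show thesis using that A by blast
qed

section \<open>The super domination number of the product\<close>

theorem proposition19:
  fixes H :: "'a pair_pre_digraph" and n n' :: nat
  assumes "pair_graph H"
    and "parcs H \<noteq> {}"
    and "card (pverts H) = n'"
    and "n \<ge> 4"
  shows "(int (super_domination_number H) = int n' - 1 \<and> \<not> graph_iso H (complete_pgraph n') \<longrightarrow>
      int (super_domination_number (lex_product (cycle_pgraph n) H))
        = int n * int n' - \<lfloor>2 * real n / 3\<rfloor>) \<and>
    (int (super_domination_number H) \<le> int n' - 2 \<longrightarrow>
      int (super_domination_number (lex_product (cycle_pgraph n) H))
        = \<lfloor>real n / 2\<rfloor> * int (super_domination_number H) + int n' * \<lceil>real n / 2\<rceil>)"
proof (intro conjI impI)
  interpret H: pair_graph H by fact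
  let ?P = "lex_product (cycle_pgraph n) H"
  have fin: "finite (pverts ?P)" by (simp add: pverts_lex_cycle)
  have card: "card (pverts ?P) = n * n'"
    using assms(3) by (simp add: pverts_lex_cycle card_cartesian_product)
  have n: "n \<ge> 3" using assms(4) by simp
  {
    assume *: "int (super_domination_number H) = int n' - 1 \<and> \<not> graph_iso H (complete_pgraph n')"
    then have gamma: "super_domination_number H + 1 = card (pverts H)"
      using assms(3) by linarith
    obtain A where A: "A \<subseteq> pverts ?P" "super_dominating_set ?P (pverts ?P - A)"
      "card A = 2 * n div 3"
      using lex_cycle_compl_two_thirds[OF n assms(1,2)] * assms(3) by blast
    have "super_domination_number ?P + card A = n * n'"
      unfolding card[symmetric] using A lex_cycle_compl_le_two_thirds[OF n assms(1) gamma]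
      by (intro super_domination_number_eqI[OF fin]) auto
    then have "int (super_domination_number ?P) + int (2 * n div 3) = int n * int n'"
      by (metis A(3) of_nat_add of_nat_mult)
    moreover have "\<lfloor>2 * real n / 3\<rfloor> = int (2 * n div 3)"
      using floor_divide_of_nat_eq[of "2 * n" 3, where 'a = real] by simp
    ultimately show "int (super_domination_number ?P) = int n * int n' - \<lfloor>2 * real n / 3\<rfloor>"
      by simp
  next
    assume "int (super_domination_number H) \<le> int n' - 2"
    then obtain m where m: "super_domination_number H + m = card (pverts H)" "m \<ge> 2"
      using assms(3) that[of "n' - super_domination_number H"] by simp
    obtain A where A: "A \<subseteq> pverts ?P" "super_dominating_set ?P (pverts ?P - A)"
      "card A = n div 2 * m"
      using lex_cycle_compl_half[OF n assms(1) m(1)] .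
    have "super_domination_number ?P + card A = n * n'"
      unfolding card[symmetric] using A lex_cycle_compl_le_half[OF n assms(1) m]
      by (intro super_domination_number_eqI[OF fin]) auto
    then have total: "int (super_domination_number ?P) + int (n div 2) * int m = int n * int n'"
      by (metis A(3) of_nat_add of_nat_mult)
    have m_eq: "int m = int n' - int (super_domination_number H)"
      using m(1) assms(3) by linarith
    have floor_eq: "\<lfloor>real n / 2\<rfloor> = int (n div 2)"
      using floor_divide_of_nat_eq[of n 2, where 'a = real] by simp
    have ceiling_eq: "\<lceil>real n / 2\<rceil> = int n - int (n div 2)"
      by (rule ceiling_unique) (cases "even n"; auto elim!: evenE oddE)+
    show "int (super_domination_number ?P) =
        \<lfloor>real n / 2\<rfloor> * int (super_domination_number H) + int n' * \<lceil>real n / 2\<rceil>"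
      using total unfolding m_eq floor_eq ceiling_eq by (simp add: algebra_simps)
  }
qed

end
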